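(* Let $\eta>0$, and let $M$, $K$, $m$ be the mass matrix, stiffness matrix and mean-value vector of the piecewise linear finite element space described in the context, with $\bar K=K+mm^T$. Let $$S=\eta\bar K+M\bar K^{-1}M,\qquad S_{\mathrm{pre}}=(M+\sqrt\eta\,\bar K)\,\bar K^{-1}\,(M+\sqrt\eta\,\bar K).$$ Then every eigenvalue of the preconditioned untruncated Schur complement satisfies $$\lambda(S_{\mathrm{pre}}^{-1}S)\in[1/2,1).$$
   Context: Let $\Omega=(0,1)\times(0,1)$, let $\mathcal{T}_h$ be a triangulation of $\Omega$ with node set $\mathcal{N}_h$, $n=|\mathcal{N}_h|$, and let $(\lambda_p)_{p\in\mathcal{N}_h}$ be the nodal basis of the space of continuous functions on $\bar\Omega$ that are linear on each triangle (no boundary conditions imposed). The mass matrix is $M=(\int_\Omega \lambda_p\lambda_q\,dx)_{p,q}$, the stiffness matrix is $K=(\int_\Omega \nabla\lambda_p\cdot\nabla\lambda_q\,dx)_{p,q}$, and $m=(\int_\Omega\lambda_p\,dx)_p\in\mathbb{R}^n$. The parameter is $\eta=\epsilon\tau>0$, with $\epsilon>0$ the interface parameter and $\tau>0$ the time step. *)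

theory Defs
  imports "HOL-Analysis.Analysis"
begin

definition \<Omega> :: "(real^2) set" where
  "\<Omega> = {x. \<forall>i. 0 < x $ i \<and> x $ i < 1}"

text \<open>The library's \<^const>\<open>triangulation\<close> already demands finiteness and conformity (any two
  members meet in a common face, possibly empty); it leaves the dimension of the simplices and
  the underlying set open.\<close>

definition triangulation_of_square :: "(real^2) set set \<Rightarrow> bool" where
  "triangulation_of_square \<T> \<longleftrightarrow>
     triangulation \<T> \<and> (\<forall>T\<in>\<T>. 2 simplex T) \<and> \<Union>\<T> = closure \<Omega>"

definition nodes :: "(real^2) set set \<Rightarrow> (real^2) set" where
  "nodes \<T> = {p. \<exists>T\<in>\<T>. p extreme_point_of T}"

text \<open>Values outside the closed square are left unconstrained; nothing below depends on them.\<close>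

definition fe_space :: "(real^2) set set \<Rightarrow> (real^2 \<Rightarrow> real) set" where
  "fe_space \<T> = {v. continuous_on (closure \<Omega>) v \<and>
     (\<forall>T\<in>\<T>. \<exists>g c. \<forall>x\<in>T. v x = g \<bullet> x + c)}"

text \<open>The finite type \<open>'n\<close> numbers the nodes, so that \<open>CARD('n)\<close> is the number of nodes and
  \<open>\<phi> i\<close> is the basis function belonging to the node \<open>p i\<close>.\<close>

definition nodal_basis ::
    "(real^2) set set \<Rightarrow> ('n::finite \<Rightarrow> real^2) \<Rightarrow> ('n \<Rightarrow> real^2 \<Rightarrow> real) \<Rightarrow> bool" where
  "nodal_basis \<T> p \<phi> \<longleftrightarrow> bij_betw p UNIV (nodes \<T>) \<and>
     (\<forall>i. \<phi> i \<in> fe_space \<T> \<and> (\<forall>j. \<phi> i (p j) = (if i = j then 1 else 0)))"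

text \<open>For functions in \<^const>\<open>fe_space\<close> the gradient is the classical one inside each triangle.
  On the triangle edges, a null set, it may be an unspecified value; this does not affect the
  integrals.\<close>

definition grad :: "(real^2 \<Rightarrow> real) \<Rightarrow> real^2 \<Rightarrow> real^2" where
  "grad f x = (THE D. GDERIV f x :> D)"

definition mass_matrix :: "('n::finite \<Rightarrow> real^2 \<Rightarrow> real) \<Rightarrow> real^'n^'n" where
  "mass_matrix \<phi> = (\<chi> i j. integral \<Omega> (\<lambda>x. \<phi> i x * \<phi> j x))"

definition stiffness_matrix :: "('n::finite \<Rightarrow> real^2 \<Rightarrow> real) \<Rightarrow> real^'n^'n" where
  "stiffness_matrix \<phi> = (\<chi> i j. integral \<Omega> (\<lambda>x. grad (\<phi> i) x \<bullet> grad (\<phi> j) x))"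

definition mean_vector :: "('n::finite \<Rightarrow> real^2 \<Rightarrow> real) \<Rightarrow> real^'n" where
  "mean_vector \<phi> = (\<chi> i. integral \<Omega> (\<phi> i))"

definition K_bar :: "('n::finite \<Rightarrow> real^2 \<Rightarrow> real) \<Rightarrow> real^'n^'n" where
  "K_bar \<phi> =
     stiffness_matrix \<phi> + (\<chi> i j. mean_vector \<phi> $ i * mean_vector \<phi> $ j)"

definition schur :: "real \<Rightarrow> ('n::finite \<Rightarrow> real^2 \<Rightarrow> real) \<Rightarrow> real^'n^'n" where
  "schur \<eta> \<phi> =
     \<eta> *\<^sub>R K_bar \<phi> + mass_matrix \<phi> ** matrix_inv (K_bar \<phi>) ** mass_matrix \<phi>"

definition schur_pre :: "real \<Rightarrow> ('n::finite \<Rightarrow> real^2 \<Rightarrow> real) \<Rightarrow> real^'n^'n" where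
  "schur_pre \<eta> \<phi> =
     (mass_matrix \<phi> + sqrt \<eta> *\<^sub>R K_bar \<phi>) ** matrix_inv (K_bar \<phi>)
       ** (mass_matrix \<phi> + sqrt \<eta> *\<^sub>R K_bar \<phi>)"

text \<open>The preconditioned matrix is real but in general not symmetric, so its eigenvalues are
  taken over the complex numbers; that they are real is part of the claim.\<close>

definition eigenvalues :: "real^'n^'n \<Rightarrow> complex set" where
  "eigenvalues A = {k. \<exists>v. v \<noteq> 0 \<and> map_matrix complex_of_real A *v v = k *s v}"

end

theory Submission
  imports Defs
begin

text \<open>
  Write \<open>s = sqrt \<eta>\<close> and \<open>K\<close> for \<^const>\<open>K_bar\<close>. For symmetric positive definite \<open>M\<close> and \<open>K\<close>,
  expanding the products gives \<open>S = M K\<inverse> M + s\<^sup>2 K\<close> and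
  \<open>P = (M + s K) K\<inverse> (M + s K) = M K\<inverse> M + 2 s M + s\<^sup>2 K\<close>. Hence \<open>P - S = 2 s M\<close> is positive
  definite, and \<open>2 S - P = (M - s K) K\<inverse> (M - s K)\<close> is positive semidefinite. An eigenvalue of
  \<open>P\<inverse> S\<close> is a quotient of the quadratic forms of \<open>S\<close> and \<open>P\<close>, so it lies in \<open>[1/2, 1)\<close>; this is
  \<open>eigenvalues_real_bounds\<close> applied in \<open>eigenvalues_matching_preconditioner\<close>.

  What remains is that \<open>M\<close> and \<open>K\<close> are positive definite. For a coefficient vector \<open>x\<close> put
  \<open>v = \<Sum>i. x\<^sub>i \<phi>\<^sub>i\<close>. The quadratic forms are \<open>\<integral>v\<^sup>2\<close> and \<open>\<integral>\<bar>\<nabla>v\<bar>\<^sup>2 + (\<integral>v)\<^sup>2\<close>. If the first vanishes,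
  so does the continuous function \<open>v\<close>, and with it the nodal values \<open>x\<^sub>i\<close>. If the second vanishes,
  \<open>v\<close> has gradient zero inside every triangle, hence is constant on every triangle; a continuous
  function with finitely many values on the connected closed square is constant, and its mean
  value is zero, so again \<open>v = 0\<close> (\<open>stiffness_kernel\<close>, \<open>pos_def_K_bar\<close>). The mean-value term thus
  removes exactly the constants, which form the kernel of the stiffness matrix.
\<close>

section \<open>Positive definite matrices\<close>

text \<open>Symmetry is stated as self-adjointness because every use moves a matrix across the inner
  product.\<close>

definition pos_def :: "real^'n^'n \<Rightarrow> bool" where
  "pos_def A \<longleftrightarrow>
     (\<forall>x y. (A *v x) \<bullet> y = x \<bullet> (A *v y)) \<and> (\<forall>x. x \<noteq> 0 \<longrightarrow> 0 < x \<bullet> (A *v x))"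

lemma pos_def_sym: "pos_def A \<Longrightarrow> (A *v x) \<bullet> y = x \<bullet> (A *v y)"
  by (simp add: pos_def_def)

lemma pos_def_pos: "pos_def A \<Longrightarrow> x \<noteq> 0 \<Longrightarrow> 0 < x \<bullet> (A *v x)"
  by (simp add: pos_def_def)

lemma pos_def_nonneg: "pos_def A \<Longrightarrow> 0 \<le> x \<bullet> (A *v x)"
  by (cases "x = 0") (auto dest: pos_def_pos intro: less_imp_le)

lemma pos_def_add:
  assumes "pos_def A" "pos_def B"
  shows "pos_def (A + B)"
  using assms
  by (simp add: pos_def_def matrix_vector_mult_add_rdistrib inner_add_left inner_add_right
      add_pos_pos)

lemma pos_def_scaleR:
  assumes "pos_def A" "0 < c"
  shows "pos_def (c *\<^sub>R A)"
  using assms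
  by (simp add: pos_def_def scaleR_matrix_vector_assoc[symmetric])

lemma pos_def_invertible:
  fixes A :: "real^'n^'n"
  assumes "pos_def A"
  shows "invertible A"
proof -
  have "\<forall>x. A *v x = 0 \<longrightarrow> x = 0"
    using pos_def_pos[OF assms] by fastforce
  then show ?thesis
    using invertible_left_inverse matrix_left_invertible_ker by blast
qed

lemma matrix_inv_cancel:
  fixes A :: "real^'n^'n"
  assumes "invertible A"
  shows "A *v (matrix_inv A *v x) = x" "matrix_inv A *v (A *v x) = x"
proof -
  have "A ** matrix_inv A = mat 1 \<and> matrix_inv A ** A = mat 1"
    using assms unfolding invertible_def matrix_inv_def by (rule someI_ex)
  then show "A *v (matrix_inv A *v x) = x" "matrix_inv A *v (A *v x) = x"
    by (simp_all add: matrix_vector_mul_assoc)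
qed

lemma pos_def_matrix_inv:
  fixes A :: "real^'n^'n"
  assumes "pos_def A"
  shows "pos_def (matrix_inv A)"
proof -
  let ?B = "matrix_inv A"
  have AB: "A *v (?B *v x) = x" for x
    by (rule matrix_inv_cancel(1)[OF pos_def_invertible[OF assms]])
  have "(?B *v x) \<bullet> y = x \<bullet> (?B *v y)" for x y
    using pos_def_sym[OF assms, of "?B *v x" "?B *v y"] by (simp add: AB)
  moreover have "0 < x \<bullet> (?B *v x)" if "x \<noteq> 0" for x
  proof -
    have "?B *v x \<noteq> 0"
      using AB[of x] that by force
    from pos_def_pos[OF assms this] show ?thesis
      by (simp add: AB inner_commute)
  qed
  ultimately show ?thesis
    by (simp add: pos_def_def)
qed

lemma pos_def_congruence:
  fixes A C :: "real^'n^'n"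
  assumes "pos_def A" "pos_def C"
  shows "pos_def (C ** A ** C)"
proof -
  have quad: "x \<bullet> ((C ** A ** C) *v y) = (C *v x) \<bullet> (A *v (C *v y))" for x y
    by (simp add: matrix_vector_mul_assoc[symmetric] pos_def_sym[OF assms(2)])
  have "C *v x \<noteq> 0" if "x \<noteq> 0" for x
    using pos_def_pos[OF assms(2) that] by force
  then show ?thesis
    unfolding pos_def_def quad
    by (metis assms(1) inner_commute pos_def_def quad)
qed

text \<open>For an eigenvector \<open>v = u + \<i> w\<close> with eigenvalue \<open>k\<close> one has \<open>S v = k P v\<close>. Pairing this with
  \<open>v\<close> in the Hermitian inner product gives \<open>s = k p\<close>, where \<open>s\<close> and \<open>p > 0\<close> are the real values of
  the forms of \<open>S\<close> and \<open>P\<close> at \<open>v\<close>, each the sum of its values at \<open>u\<close> and \<open>w\<close>. So \<open>k\<close> is real and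
  inherits the bounds on the forms. The proof carries this out in real and imaginary parts.\<close>

lemma eigenvalues_real_bounds:
  fixes P S :: "real^'n^'n"
  assumes P: "pos_def P"
    and sym: "\<And>x y. (S *v x) \<bullet> y = x \<bullet> (S *v y)"
    and lower: "\<And>x. a * (x \<bullet> (P *v x)) \<le> x \<bullet> (S *v x)"
    and upper: "\<And>x. x \<noteq> 0 \<Longrightarrow> x \<bullet> (S *v x) < b * (x \<bullet> (P *v x))"
  shows "eigenvalues (matrix_inv P ** S) \<subseteq> complex_of_real ` {a..<b}"
proof
  fix k assume "k \<in> eigenvalues (matrix_inv P ** S)"
  then obtain v where v0: "v \<noteq> 0"
    and eig: "map_matrix complex_of_real (matrix_inv P ** S) *v v = k *s v"
    by (auto simp: eigenvalues_def)
  define u where "u = (\<chi> i. Re (v $ i))"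
  define w where "w = (\<chi> i. Im (v $ i))"
  have uw0: "u \<noteq> 0 \<or> w \<noteq> 0"
    using v0 by (auto simp: u_def w_def vec_eq_iff complex_eq_iff)
  have reim: "Re ((map_matrix complex_of_real C *v v) $ i) = (C *v u) $ i"
    "Im ((map_matrix complex_of_real C *v v) $ i) = (C *v w) $ i" for C :: "real^'n^'n" and i
    by (simp_all add: matrix_vector_mult_def u_def w_def)
  have cancel: "P *v ((matrix_inv P ** S) *v x) = S *v x" for x
    by (simp add: matrix_vector_mul_assoc[symmetric] matrix_inv_cancel(1) P pos_def_invertible)
  have "(matrix_inv P ** S) *v u = Re k *\<^sub>R u - Im k *\<^sub>R w"
    unfolding vec_eq_iff reim(1)[symmetric] eig by (simp add: u_def w_def)
  from arg_cong[OF this, of "(*v) P"]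
  have Su: "S *v u = Re k *\<^sub>R (P *v u) - Im k *\<^sub>R (P *v w)"
    by (simp add: cancel matrix_vector_mult_diff_distrib matrix_vector_mult_scaleR)
  have "(matrix_inv P ** S) *v w = Re k *\<^sub>R w + Im k *\<^sub>R u"
    unfolding vec_eq_iff reim(2)[symmetric] eig by (simp add: u_def w_def)
  from arg_cong[OF this, of "(*v) P"]
  have Sw: "S *v w = Re k *\<^sub>R (P *v w) + Im k *\<^sub>R (P *v u)"
    by (simp add: cancel matrix_vector_right_distrib matrix_vector_mult_scaleR)
  define p where "p = u \<bullet> (P *v u) + w \<bullet> (P *v w)"
  define s where "s = u \<bullet> (S *v u) + w \<bullet> (S *v w)"
  have Psym: "w \<bullet> (P *v u) = u \<bullet> (P *v w)"
    using pos_def_sym[OF P, of w u] by (simp add: inner_commute)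
  have Ssym: "w \<bullet> (S *v u) = u \<bullet> (S *v w)"
    using sym[of w u] by (simp add: inner_commute)
  have "p > 0"
    unfolding p_def using uw0 pos_def_pos[OF P] pos_def_nonneg[OF P]
    by (meson add_nonneg_pos add_pos_nonneg)
  \<comment> \<open>The imaginary part of the Hermitian pairing: the mixed terms cancel by symmetry.\<close>
  have "Im k * p = 0"
    using Ssym unfolding Su Sw p_def
    by (simp add: inner_diff_right inner_add_right Psym algebra_simps)
  with \<open>p > 0\<close> have im: "Im k = 0"
    by simp
  have s: "s = Re k * p"
    unfolding s_def Su Sw p_def im by (simp add: algebra_simps)
  have "a * p \<le> s"
    using lower[of u] lower[of w] unfolding p_def s_def by (simp add: algebra_simps)
  then have "a \<le> Re k"
    using s \<open>p > 0\<close> by simp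
  have le: "x \<bullet> (S *v x) \<le> b * (x \<bullet> (P *v x))" for x
    using upper[of x] by (cases "x = 0") auto
  have "s < b * p"
    using uw0 upper[of u] upper[of w] le[of u] le[of w]
    unfolding p_def s_def distrib_left by linarith
  then have "Re k < b"
    using s \<open>p > 0\<close> by simp
  have "k = complex_of_real (Re k)"
    using im by (simp add: complex_eq_iff)
  with \<open>a \<le> Re k\<close> \<open>Re k < b\<close> show "k \<in> complex_of_real ` {a..<b}"
    by (intro image_eqI[of k _ "Re k"]) auto
qed

text \<open>The identity \<open>shift\<close> below evaluates the form of \<open>(M + t K) K\<inverse> (M + t K)\<close> for every real \<open>t\<close>.
  Taking \<open>t = sqrt \<eta>\<close> gives the preconditioner; taking \<open>t = - sqrt \<eta>\<close> gives a nonnegative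
  quantity, which bounds the cross term \<open>2 sqrt \<eta> M\<close> by \<open>S\<close>.\<close>

lemma eigenvalues_matching_preconditioner:
  fixes M K :: "real^'n^'n" and \<eta> :: real
  assumes M: "pos_def M" and K: "pos_def K" and "\<eta> > 0"
  defines "C \<equiv> M + sqrt \<eta> *\<^sub>R K"
  defines "P \<equiv> C ** matrix_inv K ** C"
  defines "S \<equiv> \<eta> *\<^sub>R K + M ** matrix_inv K ** M"
  shows "eigenvalues (matrix_inv P ** S) \<subseteq> complex_of_real ` {1/2..<1}"
proof (rule eigenvalues_real_bounds)
  let ?L = "matrix_inv K" and ?s = "sqrt \<eta>"
  have s: "?s > 0" "?s * ?s = \<eta>"
    using \<open>\<eta> > 0\<close> by auto
  have L: "pos_def ?L"
    by (rule pos_def_matrix_inv[OF K])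
  have C: "pos_def C"
    unfolding C_def by (intro pos_def_add pos_def_scaleR M K s)
  show "pos_def P"
    unfolding P_def by (rule pos_def_congruence[OF L C])
  have "pos_def S"
    unfolding S_def by (intro pos_def_add pos_def_scaleR pos_def_congruence M K L \<open>\<eta> > 0\<close>)
  then show "(S *v x) \<bullet> y = x \<bullet> (S *v y)" for x y
    by (rule pos_def_sym)
  fix x :: "real^'n"
  have LK: "?L *v (K *v x) = x"
    by (rule matrix_inv_cancel(2)[OF pos_def_invertible[OF K]])
  define m where "m = x \<bullet> (M *v x)"
  define d where "d = x \<bullet> (K *v x)"
  define r where "r = (M *v x) \<bullet> (?L *v (M *v x))"
  have KLM: "(K *v x) \<bullet> (?L *v (M *v x)) = m"
    using pos_def_sym[OF L, of "K *v x" "M *v x"] by (simp add: LK m_def)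
  have shift: "(M *v x + t *\<^sub>R (K *v x)) \<bullet> (?L *v (M *v x + t *\<^sub>R (K *v x)))
      = r + 2 * t * m + t * t * d" for t
    by (simp add: matrix_vector_right_distrib matrix_vector_mult_scaleR LK KLM
        inner_add_left inner_add_right r_def[symmetric] inner_commute[of _ x]
        m_def[symmetric] d_def[symmetric] algebra_simps)
  have quadP: "x \<bullet> (P *v x) = r + 2 * ?s * m + \<eta> * d"
    using shift[of ?s]
    by (simp add: P_def matrix_vector_mul_assoc[symmetric] pos_def_sym[OF C, symmetric] s
        less_imp_le[OF \<open>\<eta> > 0\<close>])
       (simp add: C_def matrix_vector_mult_add_rdistrib scaleR_matrix_vector_assoc[symmetric])
  have quadS: "x \<bullet> (S *v x) = r + \<eta> * d"
    by (simp add: S_def matrix_vector_mult_add_rdistrib scaleR_matrix_vector_assoc[symmetric]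
        matrix_vector_mul_assoc[symmetric] pos_def_sym[OF M, symmetric] inner_add_right
        r_def d_def)
  have "0 \<le> r + 2 * (- ?s) * m + (- ?s) * (- ?s) * d"
    unfolding shift[symmetric] by (rule pos_def_nonneg[OF L])
  then have "2 * ?s * m \<le> r + \<eta> * d"
    by (simp add: less_imp_le[OF \<open>\<eta> > 0\<close>])
  then show "1/2 * (x \<bullet> (P *v x)) \<le> x \<bullet> (S *v x)"
    unfolding quadP quadS by simp
  show "x \<bullet> (S *v x) < 1 * (x \<bullet> (P *v x))" if "x \<noteq> 0"
    unfolding quadP quadS m_def using pos_def_pos[OF M that] s by simp
qed

section \<open>Gram matrices\<close>

lemma gram_matrix_sym:
  fixes F :: "'n::finite \<Rightarrow> 'a::euclidean_space \<Rightarrow> 'b::real_inner" and D :: "'a set"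
  defines "A \<equiv> (\<chi> i j. integral D (\<lambda>y. F i y \<bullet> F j y)) :: real^'n^'n"
  shows "(A *v x) \<bullet> z = x \<bullet> (A *v z)"
proof -
  have "x v* A = A *v x"
    by (simp add: A_def vec_eq_iff vector_matrix_mult_def matrix_vector_mult_def
        inner_commute mult.commute)
  then show ?thesis
    by (metis dot_lmul_matrix)
qed

lemma gram_matrix_quadratic_form:
  fixes F :: "'n::finite \<Rightarrow> 'a::euclidean_space \<Rightarrow> 'b::real_inner" and D :: "'a set"
  assumes int: "\<And>i j. (\<lambda>y. F i y \<bullet> F j y) integrable_on D"
  defines "A \<equiv> (\<chi> i j. integral D (\<lambda>y. F i y \<bullet> F j y)) :: real^'n^'n"
  shows "((\<lambda>y. (norm (\<Sum>i\<in>UNIV. x $ i *\<^sub>R F i y))\<^sup>2) has_integral x \<bullet> (A *v x)) D"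
proof -
  have "((\<lambda>y. \<Sum>i\<in>UNIV. \<Sum>j\<in>UNIV. x $ i * (x $ j * (F i y \<bullet> F j y)))
      has_integral (\<Sum>i\<in>UNIV. \<Sum>j\<in>UNIV. x $ i * (x $ j * A $ i $ j))) D"
    unfolding A_def using int
    by (intro has_integral_sum has_integral_mult_right) (auto intro: integrable_integral)
  moreover have "(\<Sum>i\<in>UNIV. \<Sum>j\<in>UNIV. x $ i * (x $ j * A $ i $ j)) = x \<bullet> (A *v x)"
    by (simp add: inner_vec_def matrix_vector_mult_def sum_distrib_left mult.commute)
  moreover have "(\<Sum>i\<in>UNIV. \<Sum>j\<in>UNIV. x $ i * (x $ j * (F i y \<bullet> F j y)))
      = (norm (\<Sum>i\<in>UNIV. x $ i *\<^sub>R F i y))\<^sup>2" for y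
    by (simp add: power2_norm_eq_inner inner_sum_left inner_sum_right sum_distrib_left
        sum.swap[of "\<lambda>i j. x $ i * (x $ j * (F i y \<bullet> F j y))"] mult.left_commute)
  ultimately show ?thesis
    by simp
qed

text \<open>A point of \<open>U\<close> lies inside a closed box contained in \<open>U\<close>. The integral over that box is squeezed
  between \<open>0\<close> and the integral over \<open>U\<close>, which reduces the claim to the known one for boxes.\<close>

lemma has_integral_0_open_imp_0:
  fixes f :: "'a::euclidean_space \<Rightarrow> real"
  assumes "open U" "continuous_on U f" "\<And>x. x \<in> U \<Longrightarrow> 0 \<le> f x" "(f has_integral 0) U" "x \<in> U"
  shows "f x = 0"
proof -
  obtain a b where ab: "cbox a b \<subseteq> U" "x \<in> box a b"
    by (rule open_contains_cbox[OF assms(1,5)])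
  have cont: "continuous_on (cbox a b) f"
    using assms(2) ab(1) continuous_on_subset by blast
  have int: "f integrable_on cbox a b"
    by (rule integrable_continuous[OF cont])
  have "integral (cbox a b) f \<le> integral U f"
    using ab(1) int has_integral_integrable[OF assms(4)]
    by (rule integral_subset_le) (use assms(3) in blast)
  moreover have "integral (cbox a b) f \<ge> 0"
    using int by (rule integral_nonneg) (use assms(3) ab(1) in blast)
  moreover have "integral U f = 0"
    using assms(4) by (rule integral_unique)
  ultimately have int0: "(f has_integral 0) (cbox a b)"
    using int by (simp add: has_integral_iff)
  show ?thesis
  proof (rule has_integral_0_cbox_imp_0[OF cont _ int0])
    show "box a b \<noteq> {}" "x \<in> cbox a b"
      using ab(2) box_subset_cbox[of a b] by blast+
    show "0 \<le> f y" if "y \<in> box a b" for y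
      using that ab(1) assms(3) box_subset_cbox[of a b] by blast
  qed
qed

section \<open>The square and its triangulation\<close>

lemma Omega_eq_box: "\<Omega> = box 0 1"
  by (auto simp: \<Omega>_def mem_box_cart)

lemma closure_Omega: "closure \<Omega> = cbox 0 1"
proof -
  have "(\<chi> i. (1/2 :: real)) \<in> (box 0 1 :: (real^2) set)"
    by (simp add: mem_box_cart)
  then have "box 0 1 \<noteq> ({} :: (real^2) set)"
    by blast
  then show ?thesis
    by (simp add: Omega_eq_box)
qed

lemma open_Omega: "open \<Omega>"
  by (simp add: Omega_eq_box open_box)

lemma has_integral_const_Omega: "((\<lambda>x. c :: real) has_integral c) \<Omega>"
proof -
  have "(0 :: real^2) \<in> cbox 0 1"
    by (simp add: mem_box_cart)
  then have "cbox 0 1 \<noteq> ({} :: (real^2) set)"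
    by blast
  then have "measure lborel (cbox 0 1 :: (real^2) set) = 1"
    by (simp add: content_cbox_cart)
  with has_integral_const[of c 0 "1 :: real^2"] show ?thesis
    by (simp add: Omega_eq_box has_integral_open_interval)
qed

lemma integrable_Omega:
  fixes f :: "real^2 \<Rightarrow> real"
  assumes "continuous_on (closure \<Omega>) f"
  shows "f integrable_on \<Omega>"
  using integrable_continuous[OF assms[unfolded closure_Omega]]
  by (simp add: Omega_eq_box integrable_on_open_interval)

text \<open>On this open set, which is the square up to a null set, the gradients of finite element
  functions are classical and locally constant. An integral over the square may be taken over
  it instead, and the integrands involving gradients are continuous there.\<close>

definition cells :: "(real^2) set set \<Rightarrow> (real^2) set" where
  "cells \<T> = (\<Union>T\<in>\<T>. interior T)"

lemma open_cells: "open (cells \<T>)"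
  by (auto simp: cells_def)

context
  fixes \<T> :: "(real^2) set set"
  assumes tri: "triangulation_of_square \<T>"
begin

lemma finite_triangulation: "finite \<T>"
  using tri by (simp add: triangulation_of_square_def triangulation_def)

lemma Union_triangulation: "\<Union>\<T> = closure \<Omega>"
  using tri by (simp add: triangulation_of_square_def)

lemma triangle_interior_nonempty:
  assumes "T \<in> \<T>"
  shows "interior T \<noteq> {}"
proof -
  have "2 simplex T"
    using tri assms by (simp add: triangulation_of_square_def)
  then have "convex T" "aff_dim T = 2"
    by (simp_all add: convex_simplex aff_dim_simplex)
  then show ?thesis
    using interior_rel_interior_gen[of T] rel_interior_eq_empty[of T] by force
qed

lemma cells_subset_Omega: "cells \<T> \<subseteq> \<Omega>"
proof -
  have "interior T \<subseteq> interior (closure \<Omega>)" if "T \<in> \<T>" for T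
    using that Union_triangulation by (intro interior_mono) blast
  then show ?thesis
    unfolding cells_def closure_Omega by (auto simp: Omega_eq_box)
qed

lemma negligible_Omega_Diff_cells: "negligible (\<Omega> - cells \<T>)"
proof (rule negligible_subset)
  show "negligible (\<Union>T\<in>\<T>. frontier T)"
    using tri finite_triangulation
    by (intro negligible_Union) (auto simp: triangulation_of_square_def
        intro!: negligible_convex_frontier convex_simplex)
  show "\<Omega> - cells \<T> \<subseteq> (\<Union>T\<in>\<T>. frontier T)"
  proof
    fix x assume x: "x \<in> \<Omega> - cells \<T>"
    then have "x \<in> \<Union>\<T>"
      using Union_triangulation closure_subset by blast
    then obtain T where "T \<in> \<T>" "x \<in> closure T"
      using closure_subset by blast
    with x show "x \<in> (\<Union>T\<in>\<T>. frontier T)"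
      by (auto simp: cells_def frontier_def)
  qed
qed

lemma has_integral_cells_iff: "(f has_integral y) (cells \<T>) \<longleftrightarrow> (f has_integral y) \<Omega>"
  for f :: "real^2 \<Rightarrow> real"
  using cells_subset_Omega negligible_Omega_Diff_cells
  by (intro has_integral_spike_set_eq) (auto elim: negligible_subset)

lemma continuous_on_cells:
  fixes f :: "real^2 \<Rightarrow> 'b::topological_space"
  assumes "\<And>T. T \<in> \<T> \<Longrightarrow> f constant_on interior T"
  shows "continuous_on (cells \<T>) f"
  unfolding cells_def
proof (rule continuous_on_open_UN)
  fix T assume "T \<in> \<T>"
  then obtain c where "\<And>x. x \<in> interior T \<Longrightarrow> f x = c"
    using assms unfolding constant_on_def by blast
  then show "continuous_on (interior T) f"
    by (simp cong: continuous_on_cong)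
qed auto

text \<open>On \<^const>\<open>cells\<close> the function is continuous and takes finitely many values, hence is measurable
  and bounded; the edges of the triangles form a null set.\<close>

lemma integrable_piecewise_constant:
  fixes f :: "real^2 \<Rightarrow> real"
  assumes const: "\<And>T. T \<in> \<T> \<Longrightarrow> f constant_on interior T"
  shows "f integrable_on \<Omega>"
proof -
  obtain c where c: "\<And>T x. T \<in> \<T> \<Longrightarrow> x \<in> interior T \<Longrightarrow> f x = c T"
    using const unfolding constant_on_def by metis
  define b where "b = (\<Sum>T\<in>\<T>. \<bar>c T\<bar>)"
  have "(\<lambda>x. b) integrable_on cells \<T>"
    using has_integral_const_Omega[of b] has_integral_cells_iff by blast
  moreover have "norm (f x) \<le> b" if "x \<in> cells \<T>" for x
  proof -
    obtain T where "T \<in> \<T>" "f x = c T"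
      using \<open>x \<in> cells \<T>\<close> c unfolding cells_def by blast
    then show ?thesis
      using finite_triangulation by (auto simp: b_def intro!: member_le_sum)
  qed
  moreover have "cells \<T> \<in> sets lebesgue"
    using open_cells by auto
  ultimately have "f integrable_on cells \<T>"
    using continuous_on_cells[OF const] continuous_imp_measurable_on_sets_lebesgue
    by (intro measurable_bounded_by_integrable_imp_integrable[of f _ "\<lambda>x. b"]) auto
  then show ?thesis
    using has_integral_cells_iff by blast
qed

section \<open>Finite element functions\<close>

text \<open>The values on the closed square form a finite set, at most one for each triangle, and a continuous real
  function on a connected set cannot jump between finitely many values.\<close>

lemma piecewise_constant_imp_constant:
  assumes v: "continuous_on (closure \<Omega>) v"
    and const: "\<And>T. T \<in> \<T> \<Longrightarrow> v constant_on T"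
  shows "(v :: real^2 \<Rightarrow> real) constant_on closure \<Omega>"
proof (rule continuous_finite_range_constant)
  show "connected (closure \<Omega>)"
    by (simp add: closure_Omega convex_connected)
  obtain c where "\<And>T x. T \<in> \<T> \<Longrightarrow> x \<in> T \<Longrightarrow> v x = c T"
    using const unfolding constant_on_def by metis
  then have "v ` closure \<Omega> \<subseteq> c ` \<T>"
    unfolding Union_triangulation[symmetric] by blast
  then show "finite (v ` closure \<Omega>)"
    using finite_triangulation finite_surj by blast
qed (rule v)

end

lemma grad_affine:
  assumes "\<And>x. x \<in> T \<Longrightarrow> f x = g \<bullet> x + c" and "y \<in> interior T"
  shows "grad f y = g"
proof -
  have "((\<lambda>x. g \<bullet> x + c) has_derivative (\<lambda>h. g \<bullet> h)) (at y)"
    by (auto intro!: derivative_eq_intros)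
  then have "(f has_derivative (\<lambda>h. g \<bullet> h)) (at y)"
    by (rule has_derivative_transform_within_open[where s = "interior T"])
       (use assms in \<open>auto dest: subsetD[OF interior_subset]\<close>)
  then have g: "GDERIV f y :> g"
    by (simp add: gderiv_def inner_commute)
  have "D = g" if "GDERIV f y :> D" for D
  proof -
    have "(\<lambda>h. h \<bullet> D) = (\<lambda>h. h \<bullet> g)"
      using that g unfolding gderiv_def by (rule has_derivative_unique)
    then show ?thesis
      by (simp add: fun_eq_iff vector_eq_ldot)
  qed
  with g show ?thesis
    unfolding grad_def by blast
qed

lemma nodes_subset_closure_Omega:
  assumes "triangulation_of_square \<T>"
  shows "nodes \<T> \<subseteq> closure \<Omega>"
  using Union_triangulation[OF assms] by (auto simp: nodes_def extreme_point_of_def)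

context
  fixes \<T> :: "(real^2) set set"
    and p :: "'n::finite \<Rightarrow> real^2"
    and \<phi> :: "'n \<Rightarrow> real^2 \<Rightarrow> real"
  assumes tri: "triangulation_of_square \<T>"
    and basis: "nodal_basis \<T> p \<phi>"
begin

lemma basis_continuous: "continuous_on (closure \<Omega>) (\<phi> i)"
  using basis by (simp add: nodal_basis_def fe_space_def)

lemma combination_continuous: "continuous_on (closure \<Omega>) (\<lambda>y. \<Sum>i\<in>UNIV. x $ i * \<phi> i y)"
  by (intro continuous_intros basis_continuous)

text \<open>The coefficients of a linear combination of the nodal basis are its values at the nodes.\<close>

lemma coefficients_eq_0:
  assumes "\<And>y. y \<in> closure \<Omega> \<Longrightarrow> (\<Sum>i\<in>UNIV. x $ i * \<phi> i y) = 0"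
  shows "x = 0"
proof -
  have "x $ j = 0" for j
  proof -
    have "p j \<in> closure \<Omega>"
      using basis nodes_subset_closure_Omega[OF tri]
      by (auto simp: nodal_basis_def bij_betw_def)
    from assms[OF this] show ?thesis
      using basis by (simp add: nodal_basis_def if_distrib[of "(*) _"] cong: if_cong)
  qed
  then show ?thesis
    by (simp add: vec_eq_iff)
qed

text \<open>The quadratic form is the integral of the square of a continuous function. Since the integral
  only sees the open square, vanishing is carried over to the boundary nodes by continuity.\<close>

lemma pos_def_mass_matrix: "pos_def (mass_matrix \<phi>)"
proof -
  have M: "mass_matrix \<phi> = (\<chi> i j. integral \<Omega> (\<lambda>y. \<phi> i y \<bullet> \<phi> j y))"
    by (simp add: mass_matrix_def)
  have "(\<lambda>y. \<phi> i y \<bullet> \<phi> j y) integrable_on \<Omega>" for i j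
    by (intro integrable_Omega continuous_intros basis_continuous)
  from gram_matrix_quadratic_form[where F = \<phi>, OF this]
  have quad: "((\<lambda>y. (\<Sum>i\<in>UNIV. x $ i * \<phi> i y)\<^sup>2) has_integral x \<bullet> (mass_matrix \<phi> *v x)) \<Omega>"
    for x
    by (simp add: M)
  have "0 < x \<bullet> (mass_matrix \<phi> *v x)" if "x \<noteq> 0" for x
  proof -
    have "0 \<le> x \<bullet> (mass_matrix \<phi> *v x)"
      using quad by (rule has_integral_nonneg) auto
    moreover have "x \<bullet> (mass_matrix \<phi> *v x) \<noteq> 0"
    proof
      assume "x \<bullet> (mass_matrix \<phi> *v x) = 0"
      with quad[of x] have int0: "((\<lambda>y. (\<Sum>i\<in>UNIV. x $ i * \<phi> i y)\<^sup>2) has_integral 0) \<Omega>"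
        by simp
      have "continuous_on \<Omega> (\<lambda>y. (\<Sum>i\<in>UNIV. x $ i * \<phi> i y)\<^sup>2)"
        by (intro continuous_on_power continuous_on_subset[OF combination_continuous closure_subset])
      from has_integral_0_open_imp_0[OF open_Omega this _ int0]
      have "(\<Sum>i\<in>UNIV. x $ i * \<phi> i y) = 0" if "y \<in> \<Omega>" for y
        using that by auto
      then have "(\<Sum>i\<in>UNIV. x $ i * \<phi> i y) = 0" if "y \<in> closure \<Omega>" for y
        using continuous_constant_on_closure[OF combination_continuous _ that] by blast
      then have "x = 0"
        by (rule coefficients_eq_0)
      with \<open>x \<noteq> 0\<close> show False ..
    qed
    ultimately show ?thesis
      by simp
  qed
  moreover have "(mass_matrix \<phi> *v x) \<bullet> y = x \<bullet> (mass_matrix \<phi> *v y)" for x y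
    unfolding M by (rule gram_matrix_sym)
  ultimately show ?thesis
    by (simp add: pos_def_def)
qed

lemma basis_affine:
  assumes "T \<in> \<T>"
  obtains g c where "\<And>i x. x \<in> T \<Longrightarrow> \<phi> i x = g i \<bullet> x + c i"
    and "\<And>i x. x \<in> interior T \<Longrightarrow> grad (\<phi> i) x = g i"
proof -
  have "\<forall>i. \<exists>g c. \<forall>x\<in>T. \<phi> i x = g \<bullet> x + c"
    using basis assms by (simp add: nodal_basis_def fe_space_def)
  then obtain g c where "\<And>i x. x \<in> T \<Longrightarrow> \<phi> i x = g i \<bullet> x + c i"
    by metis
  moreover from this have "\<And>i x. x \<in> interior T \<Longrightarrow> grad (\<phi> i) x = g i"
    by (rule grad_affine)
  ultimately show thesis
    by (rule that)
qed

lemma stiffness_quadratic_form: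
  "((\<lambda>y. (norm (\<Sum>i\<in>UNIV. x $ i *\<^sub>R grad (\<phi> i) y))\<^sup>2)
     has_integral x \<bullet> (stiffness_matrix \<phi> *v x)) \<Omega>"
  unfolding stiffness_matrix_def
proof (intro gram_matrix_quadratic_form integrable_piecewise_constant[OF tri])
  fix i j T assume "T \<in> \<T>"
  then show "(\<lambda>y. grad (\<phi> i) y \<bullet> grad (\<phi> j) y) constant_on interior T"
    by (rule basis_affine) (auto simp: constant_on_def)
qed

lemma combination_has_integral_mean:
  "((\<lambda>y. \<Sum>i\<in>UNIV. x $ i * \<phi> i y) has_integral x \<bullet> mean_vector \<phi>) \<Omega>"
proof -
  have "((\<lambda>y. \<Sum>i\<in>UNIV. x $ i * \<phi> i y) has_integral (\<Sum>i\<in>UNIV. x $ i * integral \<Omega> (\<phi> i))) \<Omega>"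
  proof (rule has_integral_sum)
    show "((\<lambda>y. x $ i * \<phi> i y) has_integral x $ i * integral \<Omega> (\<phi> i)) \<Omega>" for i
      by (rule has_integral_mult_right[OF integrable_integral[OF integrable_Omega[OF basis_continuous]]])
  qed simp
  then show ?thesis
    by (simp add: inner_vec_def mean_vector_def)
qed

text \<open>The gradient of the combination vanishes on \<^const>\<open>cells\<close>. Each triangle has an interior point,
  and there the gradient is the linear part of the affine function on the whole triangle, so
  only the constant term is left.\<close>

lemma stiffness_kernel:
  assumes "x \<bullet> (stiffness_matrix \<phi> *v x) = 0"
  shows "(\<lambda>y. \<Sum>i\<in>UNIV. x $ i * \<phi> i y) constant_on closure \<Omega>"
proof (rule piecewise_constant_imp_constant[OF tri combination_continuous])
  let ?G = "\<lambda>y. \<Sum>i\<in>UNIV. x $ i *\<^sub>R grad (\<phi> i) y"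
  have const: "(\<lambda>y. (norm (?G y))\<^sup>2) constant_on interior T" if "T \<in> \<T>" for T
    using that by (rule basis_affine) (auto simp: constant_on_def)
  have int0: "((\<lambda>y. (norm (?G y))\<^sup>2) has_integral 0) (cells \<T>)"
    using stiffness_quadratic_form[of x] assms by (simp add: has_integral_cells_iff[OF tri])
  have G0: "?G y = 0" if "y \<in> cells \<T>" for y
    using has_integral_0_open_imp_0[OF open_cells continuous_on_cells[OF tri const] _ int0 that]
    by simp
  fix T assume T: "T \<in> \<T>"
  obtain g c where affine: "\<And>i y. y \<in> T \<Longrightarrow> \<phi> i y = g i \<bullet> y + c i"
    and grad: "\<And>i y. y \<in> interior T \<Longrightarrow> grad (\<phi> i) y = g i"
    using T by (rule basis_affine) auto
  obtain z where z: "z \<in> interior T"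
    using triangle_interior_nonempty[OF tri T] by blast
  then have "z \<in> cells \<T>"
    using T by (auto simp: cells_def)
  from G0[OF this] have g0: "(\<Sum>i\<in>UNIV. x $ i *\<^sub>R g i) = 0"
    by (simp add: grad[OF z])
  have "(\<Sum>i\<in>UNIV. x $ i * \<phi> i y) = (\<Sum>i\<in>UNIV. x $ i * c i)" if "y \<in> T" for y
  proof -
    have "(\<Sum>i\<in>UNIV. x $ i * \<phi> i y) = (\<Sum>i\<in>UNIV. x $ i *\<^sub>R g i) \<bullet> y + (\<Sum>i\<in>UNIV. x $ i * c i)"
      by (simp add: affine[OF that] inner_sum_left distrib_left sum.distrib)
    then show ?thesis
      by (simp add: g0)
  qed
  then show "(\<lambda>y. \<Sum>i\<in>UNIV. x $ i * \<phi> i y) constant_on T"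
    unfolding constant_on_def by blast
qed

lemma K_bar_mult_vec:
  "K_bar \<phi> *v x = stiffness_matrix \<phi> *v x + (x \<bullet> mean_vector \<phi>) *\<^sub>R mean_vector \<phi>"
proof -
  have "(\<chi> i j. m $ i * m $ j) *v x = (x \<bullet> m) *\<^sub>R m" for m :: "real^'n"
  proof -
    have "((\<chi> i j. m $ i * m $ j) *v x) $ i = (\<Sum>j\<in>UNIV. x $ j * m $ j * m $ i)" for i
      by (simp add: matrix_vector_mult_def mult_ac)
    then show ?thesis
      by (simp add: vec_eq_iff inner_vec_def sum_distrib_right)
  qed
  then show ?thesis
    by (simp add: K_bar_def matrix_vector_mult_add_rdistrib)
qed

text \<open>Both summands of the form are nonnegative. If both vanish, the combination is a constant with
  integral \<open>0\<close>; the unit square has area \<open>1\<close>, so the constant is \<open>0\<close>.\<close>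

lemma pos_def_K_bar: "pos_def (K_bar \<phi>)"
proof -
  have "0 < x \<bullet> (K_bar \<phi> *v x)" if "x \<noteq> 0" for x
  proof -
    have quad: "x \<bullet> (K_bar \<phi> *v x) = x \<bullet> (stiffness_matrix \<phi> *v x) + (x \<bullet> mean_vector \<phi>)\<^sup>2"
      by (simp add: K_bar_mult_vec inner_add_right power2_eq_square)
    have nonneg: "0 \<le> x \<bullet> (stiffness_matrix \<phi> *v x)"
      using stiffness_quadratic_form by (rule has_integral_nonneg) auto
    have "\<not> (x \<bullet> (stiffness_matrix \<phi> *v x) = 0 \<and> x \<bullet> mean_vector \<phi> = 0)"
    proof
      assume 0: "x \<bullet> (stiffness_matrix \<phi> *v x) = 0 \<and> x \<bullet> mean_vector \<phi> = 0"
      then obtain a where a: "\<And>y. y \<in> closure \<Omega> \<Longrightarrow> (\<Sum>i\<in>UNIV. x $ i * \<phi> i y) = a"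
        using stiffness_kernel unfolding constant_on_def by blast
      have "((\<lambda>y. \<Sum>i\<in>UNIV. x $ i * \<phi> i y) has_integral a) \<Omega>"
      proof (rule has_integral_eq[OF _ has_integral_const_Omega])
        show "a = (\<Sum>i\<in>UNIV. x $ i * \<phi> i y)" if "y \<in> \<Omega>" for y
          using a that closure_subset by (metis subsetD)
      qed
      with combination_has_integral_mean[of x] 0 have "a = 0"
        by (metis has_integral_unique)
      with a have "x = 0"
        by (intro coefficients_eq_0) auto
      with \<open>x \<noteq> 0\<close> show False ..
    qed
    then show ?thesis
      unfolding quad using nonneg
      by (cases "x \<bullet> mean_vector \<phi> = 0") (auto simp: less_le add_nonneg_eq_0_iff)
  qed
  moreover have "(K_bar \<phi> *v x) \<bullet> y = x \<bullet> (K_bar \<phi> *v y)" for x y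
  proof -
    have "(stiffness_matrix \<phi> *v x) \<bullet> y = x \<bullet> (stiffness_matrix \<phi> *v y)"
      unfolding stiffness_matrix_def by (rule gram_matrix_sym)
    then show ?thesis
      by (simp add: K_bar_mult_vec inner_add_left inner_add_right inner_commute[of y])
  qed
  ultimately show ?thesis
    by (simp add: pos_def_def)
qed

end

theorem theorem5p2:
  fixes \<T> :: "(real^2) set set"
    and p :: "'n::finite \<Rightarrow> real^2"
    and \<phi> :: "'n \<Rightarrow> real^2 \<Rightarrow> real"
    and \<eta> :: real
  assumes "triangulation_of_square \<T>"
    and "nodal_basis \<T> p \<phi>"
    and "\<eta> > 0"
  shows "eigenvalues (matrix_inv (schur_pre \<eta> \<phi>) ** schur \<eta> \<phi>)
           \<subseteq> complex_of_real ` {1/2..<1}"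
  unfolding schur_def schur_pre_def
  using assms
  by (intro eigenvalues_matching_preconditioner pos_def_mass_matrix pos_def_K_bar)

end
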